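(* Let $f(\mathbf{x})=\mathbf{x}^{T}A\mathbf{x}+b^{T}\mathbf{x}+1$ with $A\in\mathbb{R}^{n\times n}$ symmetric, $b\in\mathbb{R}^n$, $A\neq 0$, and suppose $f(\mathbf{x})=\det(I_k+x_1A_1+\dots+x_nA_n)$ for some $k\ge 2$ and Hermitian (or real symmetric) $k\times k$ matrices $A_1,\dots,A_n$. If $A$ is not negative semidefinite, then the spectrahedron $S=\{\mathbf{x}\in\mathbb{R}^n: I_k+\sum_j x_jA_j\succeq 0\}$ contains a full dimensional cone; more precisely, there exists $v\in\mathbb{R}^n$ with $\sum_j v_jA_j\succeq 0$ and $\operatorname{rank}(\sum_j v_jA_j)=2=\deg f$.
   Context: For $f(\mathbf{x})=\det(I+x_1A_1+\dots+x_nA_n)$ of degree $d$ and $S=\{\mathbf{x}: I+\sum_j x_jA_j\succeq 0\}$, the spectrahedron $S$ is said to contain a full dimensional cone if there exists $\mathbf{x}\in\mathbb{R}^n$ such that $L(\mathbf{x}):=x_1A_1+\dots+x_nA_n\succeq 0$ and $\operatorname{rank}L(\mathbf{x})=d$ (equivalently, the half ray $\{\lambda\mathbf{x}:\lambda\ge0\}$ lies in $S$ and $\operatorname{rank}L(\mathbf{x})=d$). *)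

theory Defs
  imports "HOL-Analysis.Analysis"
begin

definition hermitian_mat :: "complex^'k^'k \<Rightarrow> bool" where
  "hermitian_mat M \<longleftrightarrow> (\<forall>i j. M $ i $ j = cnj (M $ j $ i))"

text \<open>Positive semidefinite (Hermitian) matrix: Hermitian and x* M x \<ge> 0 for all complex x.\<close>
definition psd_mat :: "complex^'k^'k \<Rightarrow> bool" where
  "psd_mat M \<longleftrightarrow> hermitian_mat M \<and>
     (\<forall>x::complex^'k. 0 \<le> Re (\<Sum>i\<in>UNIV. \<Sum>j\<in>UNIV. cnj (x $ i) * M $ i $ j * x $ j))"

text \<open>The linear pencil L(x) = x_1 A_1 + ... + x_n A_n.\<close>
definition pencil :: "('n::finite \<Rightarrow> complex^'k^'k) \<Rightarrow> real^'n \<Rightarrow> complex^'k^'k" where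
  "pencil As x = (\<Sum>j\<in>UNIV. (x $ j) *\<^sub>R As j)"

end

theory Submission
  imports Defs "HOL-Computational_Algebra.Polynomial"
begin

text \<open>Pick \<open>v\<close> with \<open>v\<^sup>T A v > 0\<close> and diagonalise the Hermitian matrix \<open>L(v)\<close> with eigenvalues
  \<open>\<mu>\<^sub>j\<close>. Along the ray \<open>t v\<close> the determinantal representation becomes
  \<open>\<Prod>\<^sub>j (1 + t \<mu>\<^sub>j) = (v\<^sup>T A v) t\<^sup>2 + (b\<^sup>T v) t + 1\<close>, so comparing degrees exactly two
  eigenvalues are nonzero, and their product \<open>v\<^sup>T A v\<close> is positive. Hence they have the same
  sign, and \<open>L(v)\<close> or \<open>L(-v)\<close> is positive semidefinite of rank 2. The spectral theorem for
  Hermitian matrices is obtained by maximising the Rayleigh quotient on orthogonal complements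
  of eigenvectors.\<close>

definition cinner :: "complex^'k \<Rightarrow> complex^'k \<Rightarrow> complex" where
  "cinner x y = (\<Sum>i\<in>UNIV. cnj (x$i) * y$i)"

definition ctranspose :: "complex^'n^'m \<Rightarrow> complex^'m^'n" where
  "ctranspose A = (\<chi> i j. cnj (A$j$i))"

definition unitary_mat :: "complex^'k^'k \<Rightarrow> bool" where
  "unitary_mat U \<longleftrightarrow> ctranspose U ** U = mat 1"

definition diag_mat :: "('k \<Rightarrow> real) \<Rightarrow> complex^'k^'k" where
  "diag_mat \<mu> = (\<chi> i j. if i = j then complex_of_real (\<mu> i) else 0)"

definition orthonormal :: "(complex^'k) set \<Rightarrow> bool" where
  "orthonormal B \<longleftrightarrow> (\<forall>b\<in>B. \<forall>c\<in>B. cinner b c = (if b = c then 1 else 0))"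

lemma cinner_add_left: "cinner (x + y) z = cinner x z + cinner y z"
  and cinner_add_right: "cinner z (x + y) = cinner z x + cinner z y"
  and cinner_diff_right: "cinner z (x - y) = cinner z x - cinner z y"
  and cinner_smult_left: "cinner (c *s x) z = cnj c * cinner x z"
  and cinner_smult_right: "cinner z (c *s x) = c * cinner z x"
  and cinner_zero_right [simp]: "cinner z 0 = 0"
  by (simp_all add: cinner_def algebra_simps sum.distrib sum_subtractf sum_distrib_left)

lemma cinner_sum_right: "cinner c (\<Sum>v\<in>B. f v) = (\<Sum>v\<in>B. cinner c (f v))"
  by (induct B rule: infinite_finite_induct) (simp_all add: cinner_add_right)

lemma cnj_cinner: "cnj (cinner x y) = cinner y x"
  by (simp add: cinner_def mult.commute)

lemma cinner_self: "cinner x x = complex_of_real ((norm x)\<^sup>2)"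
proof -
  have "cnj (x$i) * x$i = complex_of_real ((cmod (x$i))\<^sup>2)" for i
    by (metis complex_norm_square mult.commute of_real_power)
  then have "cinner x x = complex_of_real (\<Sum>i\<in>UNIV. (cmod (x$i))\<^sup>2)"
    unfolding cinner_def of_real_sum by (rule sum.cong[OF refl])
  also have "(\<Sum>i\<in>UNIV. (cmod (x$i))\<^sup>2) = (norm x)\<^sup>2"
    by (simp add: norm_vec_def L2_set_def sum_nonneg)
  finally show ?thesis .
qed

lemma cinner_self_eq_zero [simp]: "cinner x x = 0 \<longleftrightarrow> x = 0"
  by (simp add: cinner_self)

lemma matrix_vector_mult_smult: "M *v (c *s x) = c *s (M *v (x::'a::comm_ring_1^'k))"
  by (simp add: vec_eq_iff matrix_vector_mult_def sum_distrib_left algebra_simps)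

lemma scaleR_eq_smult_of_real: "r *\<^sub>R (x::complex^'k) = complex_of_real r *s x"
  unfolding vec_eq_iff vector_scaleR_component vector_smult_component
  by (simp add: scaleR_conv_of_real)

lemma ctranspose_ctranspose [simp]: "ctranspose (ctranspose A) = A"
  by (simp add: ctranspose_def vec_eq_iff)

lemma ctranspose_mult: "ctranspose (A ** B) = ctranspose B ** ctranspose A"
  by (simp add: ctranspose_def matrix_matrix_mult_def vec_eq_iff mult.commute)

lemma ctranspose_diag_mat [simp]: "ctranspose (diag_mat \<mu>) = diag_mat \<mu>"
  by (simp add: ctranspose_def diag_mat_def vec_eq_iff)

lemma hermitian_mat_iff_ctranspose: "hermitian_mat M \<longleftrightarrow> ctranspose M = M"
  unfolding hermitian_mat_def ctranspose_def vec_eq_iff by (simp add: eq_commute)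

lemma cinner_matrix_vector_mult: "cinner x (A *v y) = cinner (ctranspose A *v x) y"
proof -
  have "cinner x (A *v y) = (\<Sum>i\<in>UNIV. \<Sum>j\<in>UNIV. cnj (x$i) * A$i$j * y$j)"
    by (simp add: cinner_def matrix_vector_mult_def sum_distrib_left mult.assoc)
  also have "\<dots> = (\<Sum>j\<in>UNIV. \<Sum>i\<in>UNIV. cnj (x$i) * A$i$j * y$j)"
    by (rule sum.swap)
  also have "\<dots> = cinner (ctranspose A *v x) y"
    by (simp add: cinner_def ctranspose_def matrix_vector_mult_def sum_distrib_left ac_simps)
  finally show ?thesis .
qed

lemma hermitian_cinner:
  assumes "hermitian_mat M"
  shows "cinner x (M *v y) = cinner (M *v x) y"
  using assms by (simp add: cinner_matrix_vector_mult hermitian_mat_iff_ctranspose)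

lemma psd_mat_iff_cinner:
  "psd_mat M \<longleftrightarrow> hermitian_mat M \<and> (\<forall>x. 0 \<le> Re (cinner x (M *v x)))"
proof -
  have "cinner x (M *v x) = (\<Sum>i\<in>UNIV. \<Sum>j\<in>UNIV. cnj (x $ i) * M $ i $ j * x $ j)" for x
    by (simp add: cinner_def matrix_vector_mult_def sum_distrib_left mult.assoc)
  then show ?thesis by (simp add: psd_mat_def)
qed

lemma unitary_mat_right_inverse: "unitary_mat U \<Longrightarrow> U ** ctranspose U = mat 1"
  by (simp add: unitary_mat_def matrix_left_right_inverse)

lemma linear_coeff_zero_if_quadratic_nonpos:
  fixes a c :: real
  assumes "\<And>e. 2*e*a + e\<^sup>2*c \<le> 0"
  shows "a = 0"
proof (rule ccontr)
  assume a: "a \<noteq> 0"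
  define d where "d = \<bar>c\<bar> + 1"
  have d: "d > 0" by (simp add: d_def)
  have "2*(a/d)*a + (a/d)\<^sup>2*c = a\<^sup>2 * (2*d + c) / d\<^sup>2"
    using d by (simp add: field_simps power2_eq_square)
  moreover have "a\<^sup>2 * (2*d + c) / d\<^sup>2 > 0"
    using a d by (intro divide_pos_pos mult_pos_pos) (auto simp: d_def)
  ultimately show False using assms[of "a/d"] by linarith
qed

lemma hermitian_form_add_scaled:
  assumes "hermitian_mat M"
  shows "Re (cinner (u + complex_of_real e *s w) (M *v (u + complex_of_real e *s w)))
     = Re (cinner u (M *v u)) + 2*e*Re (cinner w (M *v u)) + e\<^sup>2 * Re (cinner w (M *v w))"
proof -
  have "cinner u (M *v w) = cnj (cinner w (M *v u))"
    using hermitian_cinner[OF assms, of u w] cnj_cinner[of w "M *v u"] by simp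
  then have "Re (cinner u (M *v w)) = Re (cinner w (M *v u))" by simp
  then show ?thesis
    by (simp add: matrix_vector_mult_smult cinner_add_left
        cinner_add_right cinner_smult_left cinner_smult_right algebra_simps power2_eq_square)
qed

lemma norm_add_scaled_square:
  "(norm (u + complex_of_real e *s w))\<^sup>2 = (norm u)\<^sup>2 + 2*e*Re (cinner w u) + e\<^sup>2 * (norm w)\<^sup>2"
proof -
  have "complex_of_real ((norm (u + complex_of_real e *s w))\<^sup>2)
      = cinner (u + complex_of_real e *s w) (u + complex_of_real e *s w)"
    by (simp add: cinner_self)
  also have "\<dots> = cinner u u + complex_of_real e * (cinner w u + cnj (cinner w u))
        + complex_of_real e * complex_of_real e * cinner w w"
    by (simp add: cinner_add_left cinner_add_right cinner_smult_left cinner_smult_right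
        cnj_cinner algebra_simps)
  finally have "(norm (u + complex_of_real e *s w))\<^sup>2
      = Re (cinner u u + complex_of_real e * (cinner w u + cnj (cinner w u))
        + complex_of_real e * complex_of_real e * cinner w w)"
    by (metis Re_complex_of_real)
  then show ?thesis by (simp add: cinner_self power2_eq_square)
qed

text \<open>The first variation of the Rayleigh quotient at a maximiser on an invariant subspace vanishes.\<close>

lemma hermitian_maximiser_is_eigenvector:
  fixes M :: "complex^'k^'k"
  assumes herm: "hermitian_mat M" and W: "vec.subspace W"
    and y: "y \<in> W" "norm y = 1" and My: "M *v y \<in> W"
    and max: "\<And>z. z \<in> W \<Longrightarrow> Re (cinner z (M *v z)) \<le> Re (cinner y (M *v y)) * (norm z)\<^sup>2"
  shows "M *v y = complex_of_real (Re (cinner y (M *v y))) *s y"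
proof -
  define m where "m = Re (cinner y (M *v y))"
  define w where "w = M *v y - complex_of_real m *s y"
  have orth: "Re (cinner z w) = 0" if z: "z \<in> W" for z
  proof -
    have "2*e*(Re (cinner z (M *v y)) - m * Re (cinner z y))
          + e\<^sup>2 * (Re (cinner z (M *v z)) - m * (norm z)\<^sup>2) \<le> 0" for e
    proof -
      have "y + complex_of_real e *s z \<in> W"
        using y z W by (intro vec.subspace_add vec.subspace_scale)
      from max[OF this] show ?thesis
        unfolding hermitian_form_add_scaled[OF herm] norm_add_scaled_square
        using y by (simp add: m_def algebra_simps)
    qed
    then have "Re (cinner z (M *v y)) - m * Re (cinner z y) = 0"
      by (rule linear_coeff_zero_if_quadratic_nonpos)
    then show ?thesis by (simp add: w_def cinner_diff_right cinner_smult_right)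
  qed
  have "w \<in> W" unfolding w_def using W y My by (intro vec.subspace_diff vec.subspace_scale)
  then have "Re (cinner w w) = 0" and "Re (cinner (\<i> *s w) w) = 0"
    using W by (auto intro: orth vec.subspace_scale)
  then have "cinner w w = 0" by (simp add: cinner_smult_left complex_eq_iff)
  then show ?thesis by (simp add: w_def m_def)
qed

lemma hermitian_form_smult_of_real:
  "Re (cinner (complex_of_real r *s z) (M *v (complex_of_real r *s z))) = r\<^sup>2 * Re (cinner z (M *v z))"
  by (simp add: matrix_vector_mult_smult cinner_smult_left cinner_smult_right power2_eq_square)

lemma hermitian_form_le_sphere_bound:
  assumes W: "vec.subspace W" and z: "z \<in> W"
    and bound: "\<And>u. u \<in> W \<inter> sphere 0 1 \<Longrightarrow> Re (cinner u (M *v u)) \<le> m"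
  shows "Re (cinner z (M *v z)) \<le> m * (norm z)\<^sup>2"
proof (cases "z = 0")
  case False
  define r where "r = 1 / norm z"
  have "r *\<^sub>R z \<in> W"
    using W z by (simp add: vec.subspace_scale scaleR_eq_smult_of_real)
  moreover have "norm (r *\<^sub>R z) = 1" using False by (simp add: r_def)
  ultimately
  have "complex_of_real r *s z \<in> W \<inter> sphere 0 1"
    by (simp add: scaleR_eq_smult_of_real)
  then have "r\<^sup>2 * Re (cinner z (M *v z)) \<le> m"
    using bound hermitian_form_smult_of_real by metis
  moreover have "r\<^sup>2 * (norm z)\<^sup>2 = 1" using False by (simp add: r_def power2_eq_square)
  ultimately show ?thesis
    using False by (simp add: r_def field_simps)
qed (simp)

lemma hermitian_eigenvector_orthogonal:
  fixes M :: "complex^'k^'k"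
  assumes herm: "hermitian_mat M"
    and eig: "\<forall>b\<in>B. \<exists>\<mu>. M *v b = complex_of_real \<mu> *s b"
    and x: "x \<noteq> 0" "\<forall>b\<in>B. cinner b x = 0"
  shows "\<exists>y \<mu>. norm y = 1 \<and> (\<forall>b\<in>B. cinner b y = 0) \<and> M *v y = complex_of_real \<mu> *s y"
proof -
  define W where "W = {x. \<forall>b\<in>B. cinner b x = 0}"
  have W: "vec.subspace W"
    by (auto simp: vec.subspace_def W_def cinner_add_right cinner_smult_right)
  have "closed W"
  proof -
    have "closed {x. cinner b x = 0}" for b :: "complex^'k"
      unfolding cinner_def by (intro closed_Collect_eq continuous_intros)
    then show ?thesis unfolding W_def Collect_ball_eq by (intro closed_INT) auto
  qed
  then have "compact (W \<inter> sphere 0 1)" by (intro closed_Int_compact compact_sphere)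
  moreover have "(1 / norm x) *\<^sub>R x \<in> W \<inter> sphere 0 1"
  proof -
    have "(1 / norm x) *\<^sub>R x \<in> W"
      using x by (simp add: W_def scaleR_eq_smult_of_real cinner_smult_right)
    then show ?thesis using x by simp
  qed
  moreover have "continuous_on (W \<inter> sphere 0 1) (\<lambda>u. Re (cinner u (M *v u)))"
    unfolding cinner_def matrix_vector_mult_def by (intro continuous_intros)
  ultimately obtain y where y: "y \<in> W \<inter> sphere 0 1"
    and ymax: "\<And>u. u \<in> W \<inter> sphere 0 1 \<Longrightarrow> Re (cinner u (M *v u)) \<le> Re (cinner y (M *v y))"
    using continuous_attains_sup[of "W \<inter> sphere 0 1"] by blast
  have "M *v y \<in> W"
  proof -
    have "cinner b (M *v y) = cinner (M *v b) y" for b by (rule hermitian_cinner[OF herm])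
    then show ?thesis using eig y by (auto simp: W_def cinner_smult_left)
  qed
  then have "M *v y = complex_of_real (Re (cinner y (M *v y))) *s y"
    using y hermitian_form_le_sphere_bound[OF W _ ymax]
    by (intro hermitian_maximiser_is_eigenvector[OF herm W]) auto
  then show ?thesis using y by (auto simp: W_def)
qed

lemma orthonormal_sum_coeff:
  assumes "finite B" "orthonormal B" "c \<in> B"
  shows "cinner c (\<Sum>v\<in>B. u v *s v) = u c"
proof -
  have "cinner c (\<Sum>v\<in>B. u v *s v) = (\<Sum>v\<in>B. if v = c then u v else 0)"
    using assms(2,3) by (auto simp: cinner_sum_right cinner_smult_right orthonormal_def
        intro: sum.cong)
  also have "\<dots> = u c" using assms(1,3) by simp
  finally show ?thesis .
qed

lemma orthonormal_independent:
  assumes "finite B" "orthonormal B"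
  shows "vec.independent B"
  unfolding vec.dependent_finite[OF assms(1)]
  using orthonormal_sum_coeff[OF assms] by (metis cinner_zero_right)

lemma orthonormal_card_le:
  fixes B :: "(complex^'k) set"
  assumes "finite B" "orthonormal B"
  shows "card B \<le> CARD('k)"
proof -
  have "card B \<le> vec.dim (UNIV :: (complex^'k) set)"
    by (intro vec.independent_card_le_dim orthonormal_independent[OF assms]) auto
  then show ?thesis by (simp add: card_cart_basis)
qed

lemma orthonormal_insert:
  assumes "orthonormal B" "cinner y y = 1" "\<forall>b\<in>B. cinner b y = 0"
  shows "orthonormal (insert y B)"
proof -
  have "cinner y b = 0" if "b \<in> B" for b
    using assms(3) that cnj_cinner[of b y] by simp
  moreover have "y \<notin> B" using assms(2,3) by auto
  ultimately show ?thesis using assms by (auto simp: orthonormal_def)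
qed

text \<open>The orthogonal projection onto the span of \<open>B\<close> cannot be injective when \<open>B\<close> is too small.\<close>

lemma exists_orthogonal_vector:
  fixes B :: "(complex^'k) set"
  assumes fin: "finite B" and on: "orthonormal B" and card: "card B < CARD('k)"
  shows "\<exists>x. x \<noteq> 0 \<and> (\<forall>b\<in>B. cinner b x = 0)"
proof -
  define P :: "complex^'k^'k" where "P = (\<chi> i j. \<Sum>b\<in>B. b$i * cnj (b$j))"
  have P: "P *v x = (\<Sum>b\<in>B. cinner b x *s b)" for x
  proof -
    have "(P *v x)$i = (\<Sum>b\<in>B. \<Sum>j\<in>UNIV. b$i * cnj (b$j) * x$j)" for i
      by (simp add: P_def matrix_vector_mult_def sum_distrib_right sum.swap[of _ UNIV])
    then show ?thesis
      by (simp add: vec_eq_iff cinner_def sum_distrib_left ac_simps)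
  qed
  have "\<not> inj ((*v) P)"
  proof
    assume "inj ((*v) P)"
    then have "surj ((*v) P)" by (rule vec.linear_inj_imp_surj[OF matrix_vector_mul_linear_gen])
    moreover have "P *v x \<in> vec.span B" for x
      unfolding P by (intro vec.span_sum vec.span_scale) (rule vec.span_base)
    ultimately have "vec.dim (UNIV :: (complex^'k) set) \<le> card B"
      using vec.dim_le_card[OF _ fin] by (metis subsetI surjD)
    then show False using card by (simp add: card_cart_basis)
  qed
  then obtain x1 x2 where "x1 \<noteq> x2" "P *v x1 = P *v x2" unfolding inj_def by blast
  then have "x1 - x2 \<noteq> 0" "P *v (x1 - x2) = 0" by (simp_all add: matrix_vector_mult_diff_distrib)
  moreover have "cinner c (P *v x) = cinner c x" if "c \<in> B" for c x
    unfolding P using orthonormal_sum_coeff[OF fin on that] .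
  ultimately show ?thesis by (metis cinner_zero_right)
qed

lemma hermitian_orthonormal_eigenbasis:
  fixes M :: "complex^'k^'k"
  assumes herm: "hermitian_mat M"
  obtains B where "finite B" "orthonormal B" "card B = CARD('k)"
    "\<forall>b\<in>B. \<exists>\<mu>. M *v b = complex_of_real \<mu> *s b"
proof -
  define G where "G = {B. finite B \<and> orthonormal B \<and> (\<forall>b\<in>B. \<exists>\<mu>. M *v b = complex_of_real \<mu> *s b)}"
  have bound: "B \<in> G \<Longrightarrow> card B < CARD('k) + 1" for B
    using orthonormal_card_le by (fastforce simp: G_def)
  have "{} \<in> G" by (simp add: G_def orthonormal_def)
  then obtain B where BG: "B \<in> G" and Bmax: "\<And>B'. B' \<in> G \<Longrightarrow> card B' \<le> card B"
    using ex_has_greatest_nat[of "\<lambda>B. B \<in> G" "{}" card "CARD('k) + 1"] bound by blast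
  then have fin: "finite B" and on: "orthonormal B"
    and eig: "\<forall>b\<in>B. \<exists>\<mu>. M *v b = complex_of_real \<mu> *s b" by (auto simp: G_def)
  have "card B = CARD('k)"
  proof (rule ccontr)
    assume "card B \<noteq> CARD('k)"
    then have "card B < CARD('k)" using bound[OF BG] by auto
    then obtain x where "x \<noteq> 0" "\<forall>b\<in>B. cinner b x = 0"
      using exists_orthogonal_vector[OF fin on] by blast
    then obtain y \<mu> where y: "norm y = 1" "\<forall>b\<in>B. cinner b y = 0" "M *v y = complex_of_real \<mu> *s y"
      using hermitian_eigenvector_orthogonal[OF herm eig] by blast
    have "cinner y y = 1" using y(1) by (simp add: cinner_self)
    then have "orthonormal (insert y B)" by (rule orthonormal_insert[OF on _ y(2)])
    then have "insert y B \<in> G" using fin eig y(3) by (auto simp: G_def)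
    moreover have "y \<notin> B" using y(2) \<open>cinner y y = 1\<close> by force
    ultimately show False using Bmax[of "insert y B"] fin by simp
  qed
  then show ?thesis by (rule that[OF fin on _ eig])
qed

text \<open>Spectral theorem: the columns of \<open>U\<close> form an orthonormal eigenbasis of \<open>M\<close>.\<close>

lemma hermitian_unitary_diagonalization:
  fixes M :: "complex^'k^'k"
  assumes "hermitian_mat M"
  obtains U \<mu> where "unitary_mat U" "M = U ** diag_mat \<mu> ** ctranspose U"
proof -
  obtain B where fin: "finite B" and on: "orthonormal B" and card: "card B = CARD('k)"
    and eig: "\<forall>b\<in>B. \<exists>\<mu>. M *v b = complex_of_real \<mu> *s b"
    by (rule hermitian_orthonormal_eigenbasis[OF assms])
  obtain g where g: "bij_betw g (UNIV :: 'k set) B"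
    using finite_same_card_bij[of "UNIV :: 'k set" B] fin card by auto
  then have gB: "g j \<in> B" and ginj: "g j = g l \<longleftrightarrow> j = l" for j l
    by (auto simp: bij_betw_def inj_def)
  define \<mu> where "\<mu> j = (SOME m. M *v g j = complex_of_real m *s g j)" for j
  have eig_g: "M *v g j = complex_of_real (\<mu> j) *s g j" for j
    unfolding \<mu>_def by (rule someI_ex) (use eig gB in blast)
  define U :: "complex^'k^'k" where "U = (\<chi> i j. g j $ i)"
  have "(ctranspose U ** U)$j$l = cinner (g j) (g l)" for j l
    by (simp add: ctranspose_def U_def matrix_matrix_mult_def cinner_def)
  also have "cinner (g j) (g l) = (if j = l then 1 else 0)" for j l
    using on gB[of j] gB[of l] ginj[of j l] by (simp add: orthonormal_def)
  finally have U: "unitary_mat U" by (simp add: unitary_mat_def vec_eq_iff mat_def)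
  have "(M ** U)$i$j = (U ** diag_mat \<mu>)$i$j" for i j
  proof -
    have "(M ** U)$i$j = (M *v g j)$i"
      by (simp add: U_def matrix_matrix_mult_def matrix_vector_mult_def)
    also have "\<dots> = complex_of_real (\<mu> j) * g j $ i" by (simp add: eig_g)
    also have "\<dots> = (U ** diag_mat \<mu>)$i$j"
      by (simp add: U_def diag_mat_def matrix_matrix_mult_def if_distrib cong: if_cong)
    finally show ?thesis .
  qed
  then have "M ** U = U ** diag_mat \<mu>" by (simp add: vec_eq_iff)
  then have "M ** (U ** ctranspose U) = U ** diag_mat \<mu> ** ctranspose U"
    by (simp add: matrix_mul_assoc)
  then have "M = U ** diag_mat \<mu> ** ctranspose U"
    by (simp add: unitary_mat_right_inverse[OF U])
  then show ?thesis by (rule that[OF U])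
qed

lemma diag_mat_vector_mult: "(diag_mat \<mu> *v y)$i = complex_of_real (\<mu> i) * y$i"
  by (simp add: diag_mat_def matrix_vector_mult_def if_distrib[where f="\<lambda>a. a * _"] cong: if_cong)

lemma psd_mat_conj_nonneg_diag:
  assumes "\<forall>j. 0 \<le> \<mu> j"
  shows "psd_mat (U ** diag_mat \<mu> ** ctranspose U)"
proof -
  have "0 \<le> Re (cinner x ((U ** diag_mat \<mu> ** ctranspose U) *v x))" for x
  proof -
    define y where "y = ctranspose U *v x"
    have "cinner x ((U ** diag_mat \<mu> ** ctranspose U) *v x) = cinner y (diag_mat \<mu> *v y)"
      by (simp add: y_def cinner_matrix_vector_mult flip: matrix_vector_mul_assoc)
    then have "Re (cinner x ((U ** diag_mat \<mu> ** ctranspose U) *v x))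
        = (\<Sum>j\<in>UNIV. \<mu> j * Re (cnj (y$j) * y$j))"
      by (simp add: cinner_def diag_mat_vector_mult mult.left_commute)
    then show ?thesis using assms by (simp add: sum_nonneg)
  qed
  moreover have "hermitian_mat (U ** diag_mat \<mu> ** ctranspose U)"
    by (simp add: hermitian_mat_iff_ctranspose ctranspose_mult matrix_mul_assoc)
  ultimately show ?thesis by (simp add: psd_mat_iff_cinner)
qed

lemma row_matrix_mult: "row i (A ** B) = (\<Sum>l\<in>UNIV. A$i$l *s row l B)"
  by (simp add: vec_eq_iff row_def matrix_matrix_mult_def)

lemma rows_matrix_mult_subset_span: "rows (A ** B) \<subseteq> vec.span (rows B)"
  unfolding rows_def row_matrix_mult
  by (auto intro!: vec.span_sum vec.span_scale intro: vec.span_base)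

lemma rank_matrix_mult_left_invertible:
  fixes A :: "'a::field^'n^'m" and B :: "'a^'p^'n"
  assumes "A' ** A = mat 1"
  shows "rank (A ** B) = rank B"
proof -
  have "rows B \<subseteq> vec.span (rows (A ** B))"
    using rows_matrix_mult_subset_span[of A' "A ** B"] assms by (simp add: matrix_mul_assoc)
  then have "vec.span (rows (A ** B)) = vec.span (rows B)"
    using rows_matrix_mult_subset_span vec.span_eq by blast
  then show ?thesis by (metis row_rank_def_gen vec.dim_span)
qed

lemma rank_diag_mat_mult_orthonormal_rows:
  assumes V: "V ** ctranspose V = mat 1"
  shows "rank (diag_mat \<mu> ** V) = card {j. \<mu> j \<noteq> 0}"
proof -
  define S where "S = {j. \<mu> j \<noteq> 0}"
  have rowV: "cinner (row l V) (row m V) = (if l = m then 1 else 0)" for l m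
  proof -
    have "cinner (row l V) (row m V) = (V ** ctranspose V)$m$l"
      by (simp add: cinner_def row_def matrix_matrix_mult_def ctranspose_def mult.commute)
    then show ?thesis using V by (simp add: mat_def)
  qed
  then have inj: "inj (\<lambda>l. row l V)" by (metis injI one_neq_zero)
  have on: "orthonormal ((\<lambda>l. row l V) ` S)"
    using rowV inj by (auto simp: orthonormal_def dest: injD)
  have row_DV: "row l (diag_mat \<mu> ** V) = complex_of_real (\<mu> l) *s row l V" for l
    by (simp add: vec_eq_iff row_def matrix_matrix_mult_def diag_mat_def
        if_distrib[where f="\<lambda>a. a * _"] cong: if_cong)
  have "rows (diag_mat \<mu> ** V) \<subseteq> vec.span ((\<lambda>l. row l V) ` S)"
  proof
    fix r assume "r \<in> rows (diag_mat \<mu> ** V)"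
    then obtain l where r: "r = complex_of_real (\<mu> l) *s row l V" by (auto simp: rows_def row_DV)
    show "r \<in> vec.span ((\<lambda>l. row l V) ` S)"
    proof (cases "l \<in> S")
      case True
      then show ?thesis unfolding r by (intro vec.span_scale vec.span_base) simp
    next
      case False
      then show ?thesis by (simp add: r S_def vec.span_zero)
    qed
  qed
  moreover have "row l V \<in> vec.span (rows (diag_mat \<mu> ** V))" if "l \<in> S" for l
  proof -
    have "(1 / complex_of_real (\<mu> l)) *s row l (diag_mat \<mu> ** V) \<in> vec.span (rows (diag_mat \<mu> ** V))"
      by (intro vec.span_scale vec.span_base) (auto simp: rows_def)
    then show ?thesis using that by (simp add: row_DV S_def vector_smult_assoc)
  qed
  ultimately have "vec.span (rows (diag_mat \<mu> ** V)) = vec.span ((\<lambda>l. row l V) ` S)"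
    by (auto simp: vec.span_eq)
  then have "rank (diag_mat \<mu> ** V) = card ((\<lambda>l. row l V) ` S)"
    using vec.dim_eq_card_independent[OF orthonormal_independent[OF _ on]]
    by (metis finite finite_imageI row_rank_def_gen vec.dim_span)
  then show ?thesis using inj by (simp add: S_def card_image inj_on_subset)
qed

lemma rank_unitary_conj_diag:
  assumes "unitary_mat U"
  shows "rank (U ** diag_mat \<mu> ** ctranspose U) = card {j. \<mu> j \<noteq> 0}"
proof -
  have "rank (U ** (diag_mat \<mu> ** ctranspose U)) = rank (diag_mat \<mu> ** ctranspose U)"
    using assms unfolding unitary_mat_def by (rule rank_matrix_mult_left_invertible)
  also have "\<dots> = card {j. \<mu> j \<noteq> 0}"
    using assms by (intro rank_diag_mat_mult_orthonormal_rows) (simp add: unitary_mat_def)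
  finally show ?thesis by (simp add: matrix_mul_assoc)
qed

lemma matrix_add_rdistrib: "(B + C) ** (A::'a::semiring_1^'n^'m) = B ** A + C ** A"
  by (simp add: matrix_matrix_mult_def vec_eq_iff sum.distrib distrib_right)

lemma det_one_plus_scaled_unitary_conj_diag:
  assumes "unitary_mat U"
  shows "det (mat 1 + t *\<^sub>R (U ** diag_mat \<mu> ** ctranspose U))
       = complex_of_real (\<Prod>j\<in>UNIV. 1 + t * \<mu> j)"
proof -
  have U: "U ** ctranspose U = mat 1" by (rule unitary_mat_right_inverse[OF assms])
  have "mat 1 + t *\<^sub>R (U ** diag_mat \<mu> ** ctranspose U)
      = U ** (mat 1 + t *\<^sub>R diag_mat \<mu>) ** ctranspose U"
    by (simp add: U matrix_add_ldistrib matrix_add_rdistrib matrix_scalar_ac scalar_matrix_assoc)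
  then have "det (mat 1 + t *\<^sub>R (U ** diag_mat \<mu> ** ctranspose U))
      = det (mat 1 + t *\<^sub>R diag_mat \<mu>) * det (U ** ctranspose U)"
    by (simp add: det_mul)
  also have "\<dots> = det (mat 1 + t *\<^sub>R diag_mat \<mu>)" by (simp add: U)
  also have "\<dots> = (\<Prod>j\<in>UNIV. (mat 1 + t *\<^sub>R diag_mat \<mu>)$j$j)"
    by (rule det_diagonal) (simp add: mat_def diag_mat_def)
  also have "\<dots> = complex_of_real (\<Prod>j\<in>UNIV. 1 + t * \<mu> j)"
    by (simp add: mat_def diag_mat_def) (simp add: scaleR_conv_of_real)
  finally show ?thesis .
qed

lemma two_nonzero_factors_if_quadratic_product:
  fixes \<mu> :: "'k::finite \<Rightarrow> real"
  assumes prod: "\<And>t. (\<Prod>j\<in>UNIV. 1 + t * \<mu> j) = q * t\<^sup>2 + \<beta> * t + 1" and q: "q \<noteq> 0"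
  obtains a c where "a \<noteq> c" "{j. \<mu> j \<noteq> 0} = {a, c}" "\<mu> a * \<mu> c = q"
proof -
  define p where "p = (\<Prod>j\<in>UNIV. [:1, \<mu> j:])"
  have "poly p = poly [:1, \<beta>, q:]"
    using prod by (auto simp: p_def poly_prod algebra_simps power2_eq_square)
  then have p: "p = [:1, \<beta>, q:]" by (simp add: poly_eq_poly_eq_iff)
  have "degree p = (\<Sum>j\<in>UNIV. degree [:1, \<mu> j:])"
    unfolding p_def by (rule degree_prod_eq_sum_degree) simp
  also have "\<dots> = (\<Sum>j\<in>{j. \<mu> j \<noteq> 0}. degree [:1, \<mu> j:])"
    by (rule sum.mono_neutral_right) auto
  also have "\<dots> = card {j. \<mu> j \<noteq> 0}" by simp
  finally have "card {j. \<mu> j \<noteq> 0} = 2" using p q by simp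
  then obtain a c where S: "{j. \<mu> j \<noteq> 0} = {a, c}" and ac: "a \<noteq> c" by (auto simp: card_2_iff)
  have "p = (\<Prod>j\<in>{a,c}. [:1, \<mu> j:])"
    unfolding p_def by (rule prod.mono_neutral_right) (use S in \<open>auto simp: one_pCons\<close>)
  also have "\<dots> = [:1, \<mu> a + \<mu> c, \<mu> a * \<mu> c:]" using ac by (simp add: algebra_simps)
  finally have "\<mu> a * \<mu> c = q" using p by simp
  then show ?thesis using that ac S by blast
qed

lemma ctranspose_pencil: "ctranspose (pencil As x) = pencil (\<lambda>j. ctranspose (As j)) x"
  by (simp add: ctranspose_def pencil_def vec_eq_iff cnj_sum)

lemma hermitian_pencil:
  assumes "\<forall>j. hermitian_mat (As j)"
  shows "hermitian_mat (pencil As x)"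
proof -
  have "ctranspose (As j) = As j" for j using assms by (simp add: hermitian_mat_iff_ctranspose)
  then show ?thesis by (simp add: hermitian_mat_iff_ctranspose ctranspose_pencil)
qed

lemma pencil_scaleR: "pencil As (t *\<^sub>R x) = t *\<^sub>R pencil As x"
  by (simp add: pencil_def scaleR_sum_right)

lemma scaleR_unitary_conj_diag:
  "c *\<^sub>R (U ** diag_mat \<mu> ** V) = U ** diag_mat (\<lambda>j. c * \<mu> j) ** V"
proof -
  have "c *\<^sub>R diag_mat \<mu> = diag_mat (\<lambda>j. c * \<mu> j)"
    unfolding diag_mat_def vec_eq_iff vector_scaleR_component by (simp add: scaleR_conv_of_real)
  then show ?thesis by (metis matrix_scalar_ac scalar_matrix_assoc)
qed

lemma prod_eigenvalues_along_ray:
  assumes det_rep: "\<forall>x. complex_of_real (x \<bullet> (A *v x) + b \<bullet> x + 1) = det (mat 1 + pencil As x)"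
    and U: "unitary_mat U" and Mv: "pencil As v = U ** diag_mat \<mu> ** ctranspose U"
  shows "(\<Prod>j\<in>UNIV. 1 + t * \<mu> j) = (v \<bullet> (A *v v)) * t\<^sup>2 + (b \<bullet> v) * t + 1"
proof -
  have "A *v (t *\<^sub>R v) = t *\<^sub>R (A *v v)"
    by (simp add: vec_eq_iff matrix_vector_mult_def sum_distrib_left algebra_simps)
  then have "(t *\<^sub>R v) \<bullet> (A *v (t *\<^sub>R v)) + b \<bullet> (t *\<^sub>R v) + 1
      = (v \<bullet> (A *v v)) * t\<^sup>2 + (b \<bullet> v) * t + 1"
    by (simp add: power2_eq_square)
  then have "complex_of_real ((v \<bullet> (A *v v)) * t\<^sup>2 + (b \<bullet> v) * t + 1)
      = complex_of_real (\<Prod>j\<in>UNIV. 1 + t * \<mu> j)"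
    using det_rep[rule_format, of "t *\<^sub>R v"]
    by (simp only: pencil_scaleR Mv det_one_plus_scaled_unitary_conj_diag[OF U])
  then show ?thesis by (simp only: of_real_eq_iff)
qed

lemma sgn_mult_nonneg_if_two_same_sign:
  fixes \<mu> :: "'k \<Rightarrow> real"
  assumes S: "{j. \<mu> j \<noteq> 0} = {a, c}" and pos: "0 < \<mu> a * \<mu> c"
  shows "\<forall>j. 0 \<le> sgn (\<mu> a) * \<mu> j" and "{j. sgn (\<mu> a) * \<mu> j \<noteq> 0} = {a, c}"
proof -
  have mu_out: "\<mu> j = 0" if "j \<noteq> a" "j \<noteq> c" for j using S that by blast
  have same_sign: "0 < \<mu> a \<and> 0 < \<mu> c \<or> \<mu> a < 0 \<and> \<mu> c < 0"
    using pos by (simp add: zero_less_mult_iff)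
  show "\<forall>j. 0 \<le> sgn (\<mu> a) * \<mu> j"
  proof
    show "0 \<le> sgn (\<mu> a) * \<mu> j" for j
      using same_sign mu_out[of j] by (cases "j = a \<or> j = c") (auto simp: sgn_pos sgn_neg)
  qed
  have "sgn (\<mu> a) \<noteq> 0" using same_sign by auto
  then show "{j. sgn (\<mu> a) * \<mu> j \<noteq> 0} = {a, c}" using S by simp
qed

theorem mainTheorem6:
  fixes A :: "real^'n^'n" and b :: "real^'n"
    and As :: "'n \<Rightarrow> complex^'k^'k"
  assumes symA: "transpose A = A"
    and A_nz: "A \<noteq> 0"
    and k_ge: "CARD('k) \<ge> 2"
    and herm: "\<forall>j. hermitian_mat (As j)"
    and det_rep: "\<forall>x::real^'n. complex_of_real (x \<bullet> (A *v x) + b \<bullet> x + 1)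
                      = det (mat 1 + pencil As x)"
    and not_nsd: "\<not> (\<forall>x::real^'n. x \<bullet> (A *v x) \<le> 0)"
  shows "\<exists>v::real^'n. psd_mat (pencil As v) \<and> rank (pencil As v) = 2"
proof -
  obtain v where q: "v \<bullet> (A *v v) > 0" using not_nsd by (auto simp: not_le)
  obtain U \<mu> where U: "unitary_mat U" and Mv: "pencil As v = U ** diag_mat \<mu> ** ctranspose U"
    by (rule hermitian_unitary_diagonalization[OF hermitian_pencil[OF herm]])
  obtain a c where ac: "a \<noteq> c" and S: "{j. \<mu> j \<noteq> 0} = {a, c}"
      and prod: "\<mu> a * \<mu> c = v \<bullet> (A *v v)"
    by (rule two_nonzero_factors_if_quadratic_product[OF prod_eigenvalues_along_ray[OF det_rep U Mv]])
      (use q in auto)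
  define \<sigma> where "\<sigma> = sgn (\<mu> a)"
  have nonneg: "\<forall>j. 0 \<le> \<sigma> * \<mu> j" and supp: "{j. \<sigma> * \<mu> j \<noteq> 0} = {a, c}"
    using sgn_mult_nonneg_if_two_same_sign[OF S] prod q by (simp_all add: \<sigma>_def)
  have "pencil As (\<sigma> *\<^sub>R v) = U ** diag_mat (\<lambda>j. \<sigma> * \<mu> j) ** ctranspose U"
    by (simp add: pencil_scaleR Mv scaleR_unitary_conj_diag)
  then have "psd_mat (pencil As (\<sigma> *\<^sub>R v))" and "rank (pencil As (\<sigma> *\<^sub>R v)) = 2"
    using psd_mat_conj_nonneg_diag[OF nonneg] rank_unitary_conj_diag[OF U] supp ac by simp_all
  then show ?thesis by blast
qed

end
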